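(* Let $U\subseteq\mathbb C^p$ be a Zariski-open subset and $f:\mathbb C^p\to Z$ a rational morphism which is regular on $U$ and satisfies $f^{-1}(Z_0)\ne\emptyset$. If $F:U\to V$ is a holomorphic map with $\pi\circ F=f$ on $U$, then $F$ is regular (a morphism of algebraic varieties $U\to V$).
   Context: $V$ is a finite-dimensional complex vector space, $G\subset GL(V)$ a finite group, $Z=V/G$ realized as $\sigma(V)\subseteq\mathbb C^m$ via a minimal system of homogeneous generators $\sigma$ of $\mathbb C[V]^G$, with quotient map $\pi=\sigma$. $V_0$ is the set of points with trivial isotropy group and $Z_0=\pi(V_0)$. *)

theory Defs
  imports "HOL-Analysis.Analysis"
begin

definition poly_fun :: "(complex^'n \<Rightarrow> complex) \<Rightarrow> bool" where
  "poly_fun p \<longleftrightarrow> (\<exists>A c. finite A \<and>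
     (\<forall>x. p x = (\<Sum>\<alpha>\<in>A. c \<alpha> * (\<Prod>i\<in>UNIV. (x $ i) ^ \<alpha> i))))"

definition homog_poly :: "nat \<Rightarrow> (complex^'n \<Rightarrow> complex) \<Rightarrow> bool" where
  "homog_poly d p \<longleftrightarrow> (\<exists>A c. finite A \<and> (\<forall>\<alpha>\<in>A. (\<Sum>i\<in>UNIV. \<alpha> i) = d) \<and>
     (\<forall>x. p x = (\<Sum>\<alpha>\<in>A. c \<alpha> * (\<Prod>i\<in>UNIV. (x $ i) ^ \<alpha> i))))"

definition zariski_open :: "(complex^'n) set \<Rightarrow> bool" where
  "zariski_open U \<longleftrightarrow> (\<exists>P. (\<forall>p\<in>P. poly_fun p) \<and> U = - {x. \<forall>p\<in>P. p x = 0})"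

definition regular_fun_on :: "(complex^'n) set \<Rightarrow> (complex^'n \<Rightarrow> complex) \<Rightarrow> bool" where
  "regular_fun_on U h \<longleftrightarrow> (\<forall>x\<in>U. \<exists>p q W. poly_fun p \<and> poly_fun q \<and> zariski_open W \<and>
      x \<in> W \<and> W \<subseteq> U \<and> (\<forall>y\<in>W. q y \<noteq> 0 \<and> h y = p y / q y))"

definition regular_map_on :: "(complex^'n) set \<Rightarrow> (complex^'n \<Rightarrow> complex^'m) \<Rightarrow> bool" where
  "regular_map_on U F \<longleftrightarrow> (\<forall>i. regular_fun_on U (\<lambda>x. F x $ i))"

definition holo_map_on :: "(complex^'n) set \<Rightarrow> (complex^'n \<Rightarrow> complex^'m) \<Rightarrow> bool" where
  "holo_map_on U F \<longleftrightarrow> (\<forall>x\<in>U. \<exists>L. (F has_derivative L) (at x) \<and>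
      (\<forall>c v. L (c *s v) = c *s L v))"

definition finite_matrix_group :: "(complex^'n^'n) set \<Rightarrow> bool" where
  "finite_matrix_group G \<longleftrightarrow> finite G \<and> mat 1 \<in> G \<and> (\<forall>g\<in>G. invertible g) \<and>
     (\<forall>g\<in>G. \<forall>h\<in>G. g ** h \<in> G) \<and> (\<forall>g\<in>G. matrix_inv g \<in> G)"

definition invariant_poly :: "(complex^'n^'n) set \<Rightarrow> (complex^'n \<Rightarrow> complex) \<Rightarrow> bool" where
  "invariant_poly G p \<longleftrightarrow> poly_fun p \<and> (\<forall>g\<in>G. \<forall>x. p (g *v x) = p x)"

definition generates_invariants ::
  "(complex^'n^'n) set \<Rightarrow> 'm set \<Rightarrow> (complex^'n \<Rightarrow> complex^'m) \<Rightarrow> bool" where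
  "generates_invariants G S \<sigma> \<longleftrightarrow> (\<forall>p. invariant_poly G p \<longrightarrow>
     (\<exists>q. poly_fun q \<and> (\<forall>y y'. (\<forall>k\<in>S. y $ k = y' $ k) \<longrightarrow> q y = q y') \<and>
          (\<forall>x. p x = q (\<sigma> x))))"

definition min_homog_generators :: "(complex^'n^'n) set \<Rightarrow> (complex^'n \<Rightarrow> complex^'m) \<Rightarrow> bool" where
  "min_homog_generators G \<sigma> \<longleftrightarrow>
     (\<forall>j. invariant_poly G (\<lambda>x. \<sigma> x $ j) \<and> (\<exists>d. homog_poly d (\<lambda>x. \<sigma> x $ j))) \<and>
     generates_invariants G UNIV \<sigma> \<and>
     (\<forall>j. \<not> generates_invariants G (- {j}) \<sigma>)"

definition V0 :: "(complex^'n^'n) set \<Rightarrow> (complex^'n) set" where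
  "V0 G = {x. {g\<in>G. g *v x = x} = {mat 1}}"

end

theory Submission
  imports Defs "HOL-Complex_Analysis.Cauchy_Integral_Formula"
begin

text \<open>
  Each coordinate of \<open>F\<close> is a root of \<open>\<Prod>g\<in>G. (T - (g v) $ i)\<close> at \<open>v = F x\<close>, whose coefficients are
  polynomials in \<open>\<sigma> v = f x\<close>; so it is bounded by a power of \<open>1 + norm (f x)\<close>. Near a given point,
  \<open>f\<close> has a common denominator \<open>Q\<close>, hence \<open>Q ^ d * F x $ i\<close> has polynomial growth on \<open>{Q \<noteq> 0}\<close> for
  suitable \<open>d\<close>. Two further factors \<open>Q\<close> make the extension by zero entire in each variable, and by
  Liouville's theorem it is a polynomial \<open>K\<close>. Thus \<open>F x $ i = K x / Q x ^ (d + 2)\<close>.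
\<close>

section \<open>Polynomial functions\<close>

text \<open>In \<open>poly_fun\<close> every exponent vector indexes at most one monomial. Here the
  family \<open>e\<close> may repeat exponents, and the coefficients over each fibre of
  \<open>e\<close> are added up. Closure under sums and products then only requires choosing an
  index set.\<close>

lemma poly_fun_sum_monomials:
  fixes e :: "'t \<Rightarrow> 'n::finite \<Rightarrow> nat"
  assumes "finite T"
  shows "poly_fun (\<lambda>x. \<Sum>t\<in>T. c t * (\<Prod>i\<in>UNIV. (x $ i) ^ e t i))"
  unfolding poly_fun_def
proof (intro exI conjI allI)
  show "finite (e ` T)" using assms by simp
  fix x :: "complex^'n"
  have "(\<Sum>\<alpha>\<in>e ` T. (\<Sum>t\<in>{t\<in>T. e t = \<alpha>}. c t) * (\<Prod>i\<in>UNIV. (x $ i) ^ \<alpha> i))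
      = (\<Sum>\<alpha>\<in>e ` T. \<Sum>t\<in>{t\<in>T. e t = \<alpha>}. c t * (\<Prod>i\<in>UNIV. (x $ i) ^ e t i))"
    by (auto simp: sum_distrib_right intro!: sum.cong)
  also have "\<dots> = (\<Sum>t\<in>T. c t * (\<Prod>i\<in>UNIV. (x $ i) ^ e t i))"
    using assms by (intro sum.group) auto
  finally show "(\<Sum>t\<in>T. c t * (\<Prod>i\<in>UNIV. (x $ i) ^ e t i))
      = (\<Sum>\<alpha>\<in>e ` T. (\<Sum>t\<in>{t\<in>T. e t = \<alpha>}. c t) * (\<Prod>i\<in>UNIV. (x $ i) ^ \<alpha> i))" by simp
qed

lemma poly_fun_const: "poly_fun (\<lambda>x::complex^'n. c)"
  using poly_fun_sum_monomials[of "{()}" "\<lambda>_. c" "\<lambda>_ (_::'n). 0"] by simp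

lemma poly_fun_nth: "poly_fun (\<lambda>x::complex^'n. x $ i)"
proof -
  have "(\<Prod>j\<in>UNIV. (x $ j) ^ (if j = i then 1 else 0)) = x $ i" for x :: "complex^'n"
    by (simp add: if_distrib prod.delta cong: if_cong)
  then show ?thesis
    using poly_fun_sum_monomials[of "{()}" "\<lambda>_. 1" "\<lambda>_ (j::'n). if j = i then 1 else 0"] by simp
qed

lemma poly_fun_add:
  assumes "poly_fun p" "poly_fun q"
  shows "poly_fun (\<lambda>x. p x + q x)"
proof -
  obtain A c where A: "finite A" "p = (\<lambda>x. \<Sum>\<alpha>\<in>A. c \<alpha> * (\<Prod>i\<in>UNIV. (x $ i) ^ \<alpha> i))"
    using assms(1) unfolding poly_fun_def by blast
  obtain B d where B: "finite B" "q = (\<lambda>x. \<Sum>\<alpha>\<in>B. d \<alpha> * (\<Prod>i\<in>UNIV. (x $ i) ^ \<alpha> i))"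
    using assms(2) unfolding poly_fun_def by blast
  show ?thesis
    using poly_fun_sum_monomials[of "A <+> B" "case_sum c d" "case_sum id id"] A B
    by (simp add: sum.Plus)
qed

lemma poly_fun_mult:
  assumes "poly_fun p" "poly_fun q"
  shows "poly_fun (\<lambda>x. p x * q x)"
proof -
  obtain A c where A: "finite A" "p = (\<lambda>x. \<Sum>\<alpha>\<in>A. c \<alpha> * (\<Prod>i\<in>UNIV. (x $ i) ^ \<alpha> i))"
    using assms(1) unfolding poly_fun_def by blast
  obtain B d where B: "finite B" "q = (\<lambda>x. \<Sum>\<alpha>\<in>B. d \<alpha> * (\<Prod>i\<in>UNIV. (x $ i) ^ \<alpha> i))"
    using assms(2) unfolding poly_fun_def by blast
  show ?thesis
    using poly_fun_sum_monomials[of "A \<times> B" "\<lambda>(\<alpha>, \<beta>). c \<alpha> * d \<beta>" "\<lambda>(\<alpha>, \<beta>) i. \<alpha> i + \<beta> i"] A B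
    by (simp add: sum_product sum.cartesian_product case_prod_unfold power_add prod.distrib mult_ac)
qed

lemma poly_fun_sum:
  assumes "\<And>t. t \<in> T \<Longrightarrow> poly_fun (p t)"
  shows "poly_fun (\<lambda>x. \<Sum>t\<in>T. p t x)"
  using assms by (induction T rule: infinite_finite_induct) (auto intro: poly_fun_const poly_fun_add)

lemma poly_fun_prod:
  assumes "\<And>t. t \<in> T \<Longrightarrow> poly_fun (p t)"
  shows "poly_fun (\<lambda>x. \<Prod>t\<in>T. p t x)"
  using assms by (induction T rule: infinite_finite_induct) (auto intro: poly_fun_const poly_fun_mult)

lemma poly_fun_power: "poly_fun p \<Longrightarrow> poly_fun (\<lambda>x. p x ^ n)"
  using poly_fun_prod[of "{..<n}" "\<lambda>_. p"] by simp

text \<open>As \<open>z\<close> varies, this runs through the line through \<open>x\<close> parallel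
  to the \<open>i\<close>-th axis. One-variable complex analysis is applied along these
  lines.\<close>

definition vec_upd :: "'a^'n \<Rightarrow> 'n \<Rightarrow> 'a \<Rightarrow> 'a^'n" where
  "vec_upd x i z = (\<chi> k. if k = i then z else x $ k)"

lemma vec_upd_nth: "vec_upd x i z $ k = (if k = i then z else x $ k)"
  by (simp add: vec_upd_def)

lemma vec_upd_triv: "vec_upd x i (x $ i) = x"
  by (simp add: vec_upd_def vec_eq_iff)

lemma has_derivative_vec_upd:
  fixes x :: "complex^'n"
  shows "((vec_upd x i) has_derivative (\<lambda>h. axis i h)) (at z)"
proof -
  have "bounded_linear (\<lambda>h::complex. axis i h :: complex^'n)"
    by (intro linear_conv_bounded_linear[THEN iffD1] linearI) (auto simp: axis_def vec_eq_iff)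
  then have "((\<lambda>w. vec_upd x i 0 + axis i w) has_derivative (\<lambda>h. 0 + axis i h)) (at z)"
    by (intro has_derivative_add has_derivative_const bounded_linear_imp_has_derivative)
  moreover have "(\<lambda>w. vec_upd x i 0 + axis i w) = vec_upd x i"
    by (auto simp: fun_eq_iff vec_eq_iff vec_upd_def axis_def)
  ultimately show ?thesis by simp
qed

lemma poly_fun_vec_upd_holomorphic:
  assumes "poly_fun p"
  shows "(\<lambda>z. p (vec_upd x i z)) holomorphic_on S"
proof -
  have "(\<lambda>z. vec_upd x i z $ k) holomorphic_on S" for k
    by (cases "k = i") (auto simp: vec_upd_nth intro: holomorphic_intros)
  then show ?thesis
    using assms unfolding poly_fun_def by (auto intro!: holomorphic_intros)
qed

section \<open>Separately polynomial functions\<close>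

text \<open>A polynomial of degree at most \<open>d\<close> is determined by its values at the nodes
  0, ..., \<open>d\<close>. The explicit formula is what later expresses a function through finitely
  many of its own slices.\<close>

lemma lagrange_interpolation:
  fixes p :: "complex poly"
  assumes "degree p \<le> d"
  shows "poly p z = (\<Sum>j\<le>d. (\<Prod>k\<in>{..d} - {j}. (z - of_nat k) / (of_nat j - of_nat k)) * poly p (of_nat j))"
proof -
  define l where "l j = (\<Prod>k\<in>{..d} - {j}. smult (1 / (of_nat j - of_nat k)) [:- of_nat k, 1 :: complex:])" for j
  have l: "poly (l j) w = (\<Prod>k\<in>{..d} - {j}. (w - of_nat k) / (of_nat j - of_nat k))" for j w
    unfolding l_def poly_prod by (intro prod.cong) (auto simp: diff_divide_distrib)
  define L where "L = (\<Sum>j\<le>d. smult (poly p (of_nat j)) (l j))"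
  have degl: "degree (l j) \<le> d" if "j \<le> d" for j
  proof -
    have "degree (l j) \<le> (\<Sum>k\<in>{..d} - {j}. degree (smult (1 / (of_nat j - of_nat k)) [:- of_nat k, 1 :: complex:]))"
      unfolding l_def by (rule order.trans[OF degree_prod_sum_le]) (simp_all add: o_def)
    also have "\<dots> \<le> (\<Sum>k\<in>{..d} - {j}. 1)" by (intro sum_mono) auto
    also have "\<dots> = d" using that by simp
    finally show ?thesis .
  qed
  have "degree L \<le> d"
    unfolding L_def by (intro degree_sum_le) (auto simp: degl)
  \<comment> \<open>Both polynomials have degree at most \<open>d\<close>, so agreement at
    \<open>d + 1\<close> distinct nodes suffices; there the basis polynomials \<open>l j\<close>
    take the values 0 and 1.\<close>
  have "p = L"
  proof (rule poly_eqI_degree[where A = "(of_nat :: nat \<Rightarrow> complex) ` {..d}"])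
    show "card ((of_nat :: nat \<Rightarrow> complex) ` {..d}) > degree p"
         "card ((of_nat :: nat \<Rightarrow> complex) ` {..d}) > degree L"
      using assms \<open>degree L \<le> d\<close> by (simp_all add: card_image inj_on_def)
    fix w :: complex
    assume "w \<in> of_nat ` {..d}"
    then obtain m where m: "w = of_nat m" "m \<le> d" by auto
    have "poly (l j) w = (if j = m then 1 else 0)" if "j \<le> d" for j
    proof (cases "j = m")
      case True
      then show ?thesis by (auto simp: l m intro!: prod.neutral)
    next
      case False
      then show ?thesis using that m by (auto simp: l)
    qed
    then have "poly L w = (\<Sum>j\<le>d. if j = m then poly p (of_nat j) else 0)"
      unfolding L_def poly_sum by (intro sum.cong) auto
    also have "\<dots> = poly p w" using m by simp
    finally show "poly p w = poly L w" by simp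
  qed
  then have "poly p z = poly L z" by simp
  then show ?thesis by (simp add: L_def poly_sum l mult.commute)
qed

text \<open>The degree bound \<open>d\<close> is uniform over all lines, so interpolation in one
  coordinate writes \<open>K\<close> as a combination of the same \<open>d + 1\<close> slices, with
  coefficients polynomial in that coordinate. Each slice depends on one variable fewer.\<close>

lemma poly_fun_if_separately_poly:
  fixes K :: "complex^'n \<Rightarrow> complex"
  assumes "\<And>x i. \<exists>p. degree p \<le> d \<and> (\<forall>z. K (vec_upd x i z) = poly p z)"
  shows "poly_fun K"
proof -
  \<comment> \<open>Induction is on a set \<open>S\<close> of coordinates that determine
    \<open>K\<close>; for \<open>S = UNIV\<close> this dependence condition is trivial.\<close>
  have separately: "poly_fun K"
    if "finite S" "\<And>x i. i \<in> S \<Longrightarrow> \<exists>p. degree p \<le> d \<and> (\<forall>z. K (vec_upd x i z) = poly p z)"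
       "\<And>x y. (\<And>i. i \<in> S \<Longrightarrow> x $ i = y $ i) \<Longrightarrow> K x = K y"
    for S and K :: "complex^'n \<Rightarrow> complex"
    using that
  proof (induction S arbitrary: K rule: finite_induct)
    case empty
    then have "K = (\<lambda>x. K 0)" by (intro ext) blast
    then show ?case using poly_fun_const by metis
  next
    case (insert i S)
    \<comment> \<open>Freezing coordinate \<open>i\<close> at \<open>w\<close> leaves a function of
      the coordinates in \<open>S\<close>. Since \<open>i\<close> is not in \<open>S\<close>, the
      two updates commute and the degree bound is inherited.\<close>
    have "poly_fun (\<lambda>x. K (vec_upd x i w))" for w
    proof (rule insert.IH)
      fix x :: "complex^'n" and j
      assume "j \<in> S"
      then have "vec_upd (vec_upd x j z) i w = vec_upd (vec_upd x i w) j z" for z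
        using insert.hyps by (auto simp: vec_eq_iff vec_upd_nth)
      then show "\<exists>p. degree p \<le> d \<and> (\<forall>z. K (vec_upd (vec_upd x j z) i w) = poly p z)"
        using insert.prems(1)[of j "vec_upd x i w"] \<open>j \<in> S\<close> by simp
    next
      fix x y :: "complex^'n"
      assume "\<And>j. j \<in> S \<Longrightarrow> x $ j = y $ j"
      then show "K (vec_upd x i w) = K (vec_upd y i w)"
        by (intro insert.prems(2)) (auto simp: vec_upd_nth)
    qed
    moreover have "poly_fun (\<lambda>x::complex^'n. (x $ i - a) / b)" for a b
      using poly_fun_mult[OF poly_fun_add[OF poly_fun_nth[of i] poly_fun_const[of "- a"]]
          poly_fun_const[of "1 / b"]]
      by simp
    ultimately have R: "poly_fun (\<lambda>x. \<Sum>j\<le>d. (\<Prod>k\<in>{..d} - {j}. (x $ i - of_nat k) / (of_nat j - of_nat k))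
                                  * K (vec_upd x i (of_nat j)))"
      by (intro poly_fun_sum poly_fun_mult poly_fun_prod)
    have KR: "K x = (\<Sum>j\<le>d. (\<Prod>k\<in>{..d} - {j}. (x $ i - of_nat k) / (of_nat j - of_nat k))
                                  * K (vec_upd x i (of_nat j)))" for x
    proof -
      obtain p where p: "degree p \<le> d" "\<And>z. K (vec_upd x i z) = poly p z"
        using insert.prems(1)[of i x] by auto
      show ?thesis
        using lagrange_interpolation[OF p(1), of "x $ i"] p(2)[of "x $ i"] by (simp add: p(2) vec_upd_triv)
    qed
    show ?case
      by (rule iffD2[OF arg_cong[where f = poly_fun, OF ext, OF KR] R])
  qed
  show ?thesis
  proof (rule separately[of UNIV])
    show "K x = K y" if "\<And>i. i \<in> UNIV \<Longrightarrow> x $ i = y $ i" for x y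
      using that by (metis UNIV_I vec_eq_iff)
  qed (use assms in simp_all)
qed

section \<open>Polynomial growth\<close>

text \<open>The bound holds on the whole space and asks for no continuity, so it can be stated for
  an extension by zero.\<close>

definition poly_growth :: "('a::real_normed_vector \<Rightarrow> complex) \<Rightarrow> bool" where
  "poly_growth h \<longleftrightarrow> (\<exists>C d. \<forall>x. norm (h x) \<le> C * (1 + norm x) ^ d)"

lemma poly_growthE:
  assumes "poly_growth h"
  obtains C d where "C \<ge> 0" "\<And>x. norm (h x) \<le> C * (1 + norm x) ^ d"
proof -
  obtain C d where *: "\<And>x. norm (h x) \<le> C * (1 + norm x) ^ d"
    using assms unfolding poly_growth_def by blast
  have "norm (h 0) \<le> C" using *[of 0] by simp
  then have "C \<ge> 0" using norm_ge_zero order.trans by blast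
  with * that show ?thesis by blast
qed

lemma poly_growth_const: "poly_growth (\<lambda>_. c)"
  unfolding poly_growth_def by (rule exI[of _ "norm c"], rule exI[of _ 0]) simp

lemma poly_growth_mult:
  assumes "poly_growth g" "poly_growth h"
  shows "poly_growth (\<lambda>x. g x * h x)"
proof -
  obtain C d where C: "C \<ge> 0" "\<And>x. norm (g x) \<le> C * (1 + norm x) ^ d" using assms(1) by (rule poly_growthE) blast
  obtain D e where D: "D \<ge> 0" "\<And>x. norm (h x) \<le> D * (1 + norm x) ^ e" using assms(2) by (rule poly_growthE) blast
  have "norm (g x * h x) \<le> (C * D) * (1 + norm x) ^ (d + e)" for x
    using mult_mono[OF C(2)[of x] D(2)[of x]] C(1) by (simp add: norm_mult power_add mult_ac)
  then show ?thesis unfolding poly_growth_def by blast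
qed

lemma poly_growth_add:
  assumes "poly_growth g" "poly_growth h"
  shows "poly_growth (\<lambda>x. g x + h x)"
proof -
  obtain C d where C: "C \<ge> 0" "\<And>x. norm (g x) \<le> C * (1 + norm x) ^ d" using assms(1) by (rule poly_growthE) blast
  obtain D e where D: "D \<ge> 0" "\<And>x. norm (h x) \<le> D * (1 + norm x) ^ e" using assms(2) by (rule poly_growthE) blast
  have "norm (g x + h x) \<le> (C + D) * (1 + norm x) ^ (d + e)" for x
  proof -
    have "C * (1 + norm x) ^ d \<le> C * (1 + norm x) ^ (d + e)" "D * (1 + norm x) ^ e \<le> D * (1 + norm x) ^ (d + e)"
      using C(1) D(1) by (auto intro!: mult_left_mono power_increasing)
    then show ?thesis
      using norm_triangle_ineq[of "g x" "h x"] C(2)[of x] D(2)[of x] by (simp add: algebra_simps)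
  qed
  then show ?thesis unfolding poly_growth_def by blast
qed

lemma poly_growth_sum:
  assumes "\<And>t. t \<in> T \<Longrightarrow> poly_growth (p t)"
  shows "poly_growth (\<lambda>x. \<Sum>t\<in>T. p t x)"
  using assms by (induction T rule: infinite_finite_induct) (auto intro: poly_growth_const poly_growth_add)

lemma poly_growth_prod:
  assumes "\<And>t. t \<in> T \<Longrightarrow> poly_growth (p t)"
  shows "poly_growth (\<lambda>x. \<Prod>t\<in>T. p t x)"
  using assms by (induction T rule: infinite_finite_induct) (auto intro: poly_growth_const poly_growth_mult)

lemma poly_growth_power: "poly_growth p \<Longrightarrow> poly_growth (\<lambda>x. p x ^ n)"
  using poly_growth_prod[of "{..<n}" "\<lambda>_. p"] by simp

lemma poly_growth_mono:
  assumes "poly_growth g" "\<And>x. norm (h x) \<le> norm (g x)"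
  shows "poly_growth h"
  using assms unfolding poly_growth_def by (meson order.trans)

lemma poly_growth_norm: "poly_growth h \<Longrightarrow> poly_growth (\<lambda>x. of_real (norm (h x)))"
  by (rule poly_growth_mono) auto

lemma poly_fun_growth:
  assumes "poly_fun p"
  shows "poly_growth p"
proof -
  have "norm (x $ i) \<le> 1 * (1 + norm x) ^ 1" for x :: "complex^'n" and i
    using Finite_Cartesian_Product.norm_nth_le[of x i] by simp
  then have "poly_growth (\<lambda>x::complex^'n. x $ i)" for i
    unfolding poly_growth_def by blast
  moreover obtain A c where "p = (\<lambda>x. \<Sum>\<alpha>\<in>A. c \<alpha> * (\<Prod>i\<in>UNIV. (x $ i) ^ \<alpha> i))"
    using assms unfolding poly_fun_def by blast
  ultimately show ?thesis
    by (auto intro!: poly_growth_sum poly_growth_mult poly_growth_const poly_growth_prod poly_growth_power)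
qed

lemma norm_vec_upd_le: "norm (vec_upd x i z) \<le> norm x + norm (x $ i) + norm z"
  for x :: "complex^'n"
proof -
  have "vec_upd x i z = x + axis i (z - x $ i)"
    by (simp add: vec_eq_iff vec_upd_nth axis_def)
  moreover have "norm (axis i c :: complex^'n) = norm c" for c
    by (simp add: norm_vec_def L2_set_def axis_def if_distrib[of norm] if_distrib[of "\<lambda>t. t ^ 2"] cong: if_cong)
  ultimately have "norm (vec_upd x i z) \<le> norm x + norm (z - x $ i)"
    using norm_triangle_ineq[of x "axis i (z - x $ i)"] by simp
  then show ?thesis using norm_triangle_ineq4[of z "x $ i"] by linarith
qed

text \<open>On each coordinate line Liouville's theorem gives a polynomial of degree at most
  \<open>d\<close>. The constant in the growth estimate depends on the line, but the exponent
  \<open>d\<close> does not.\<close>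

lemma poly_fun_if_separately_entire:
  fixes K :: "complex^'n \<Rightarrow> complex"
  assumes "\<And>x i. (\<lambda>z. K (vec_upd x i z)) holomorphic_on UNIV" and "poly_growth K"
  shows "poly_fun K"
proof -
  obtain C d where C: "C \<ge> 0" "\<And>x. norm (K x) \<le> C * (1 + norm x) ^ d" using assms(2) by (rule poly_growthE) blast
  show ?thesis
  proof (rule poly_fun_if_separately_poly)
    fix x :: "complex^'n" and i
    let ?h = "\<lambda>z. K (vec_upd x i z)"
    \<comment> \<open>Chosen so that \<open>1 + norm x + norm (x $ i) + norm z\<close> is at most
      \<open>B * norm z\<close> once \<open>1 \<le> norm z\<close>.\<close>
    define B where "B = 2 + norm x + norm (x $ i)"
    have "norm (?h z) \<le> (C * B ^ d) * norm z ^ d" if "1 \<le> norm z" for z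
    proof -
      have "0 \<le> (norm x + norm (x $ i)) * (norm z - 1)" using that by simp
      then have "1 + norm (vec_upd x i z) \<le> B * norm z"
        using norm_vec_upd_le[of x i z] that unfolding B_def by (simp add: algebra_simps)
      then have "(1 + norm (vec_upd x i z)) ^ d \<le> (B * norm z) ^ d"
        by (intro power_mono) auto
      then have "C * (1 + norm (vec_upd x i z)) ^ d \<le> C * (B * norm z) ^ d"
        using C(1) by (rule mult_left_mono)
      then show ?thesis using C(2)[of "vec_upd x i z"] by (simp add: power_mult_distrib mult_ac)
    qed
    then have *: "?h z = (\<Sum>k\<le>d. (deriv ^^ k) ?h 0 / fact k * z ^ k)" for z
      by (rule Liouville_polynomial[OF assms(1)])
    let ?p = "\<Sum>k\<le>d. monom ((deriv ^^ k) ?h 0 / fact k) k"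
    have "degree ?p \<le> d"
      by (intro degree_sum_le) (auto intro: order.trans[OF degree_monom_le])
    moreover have "?h z = poly ?p z" for z
      using *[of z] by (simp add: poly_sum poly_monom)
    ultimately show "\<exists>p. degree p \<le> d \<and> (\<forall>z. ?h z = poly p z)" by blast
  qed
qed

section \<open>Bounding a vector by its invariants\<close>

text \<open>A Cauchy bound: if \<open>norm z\<close> exceeds 1, solve the equation for the leading
  term, estimate every lower power of \<open>z\<close> by the power \<open>degree p - 1\<close>, and
  divide by it.\<close>

lemma norm_monic_root_le:
  fixes p :: "complex poly"
  assumes "lead_coeff p = 1" "degree p > 0" "poly p z = 0"
  shows "norm z \<le> 1 + (\<Sum>k<degree p. norm (coeff p k))"
proof (cases "norm z \<le> 1")
  case True
  then show ?thesis by (smt (verit) norm_ge_zero sum_nonneg)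
next
  case False
  define n where "n = degree p"
  have "(\<Sum>k<n. coeff p k * z ^ k) + z ^ n = 0"
    using assms by (simp add: poly_altdef n_def lessThan_Suc_atMost[symmetric])
  then have "z ^ n = - (\<Sum>k<n. coeff p k * z ^ k)" by (simp add: eq_neg_iff_add_eq_0 add.commute)
  then have "norm z ^ n = norm (\<Sum>k<n. coeff p k * z ^ k)" by (metis norm_minus_cancel norm_power)
  also have "\<dots> \<le> (\<Sum>k<n. norm (coeff p k * z ^ k))" by (rule norm_sum)
  also have "\<dots> \<le> (\<Sum>k<n. norm (coeff p k) * norm z ^ (n - 1))"
    using False by (intro sum_mono) (auto simp: norm_mult norm_power intro!: mult_left_mono power_increasing)
  finally have "norm z * norm z ^ (n - 1) \<le> (\<Sum>k<n. norm (coeff p k)) * norm z ^ (n - 1)"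
    using assms(2) by (simp add: n_def sum_distrib_right power_eq_if)
  moreover have "norm z ^ (n - 1) > 0" using False by (intro zero_less_power) auto
  ultimately have "norm z \<le> (\<Sum>k<n. norm (coeff p k))" by simp
  then show ?thesis by (simp add: n_def)
qed

text \<open>The product runs over \<open>G\<close> rather than over the orbit of \<open>v\<close>.
  Its degree is therefore \<open>card G\<close> for every \<open>v\<close>, and its coefficients
  vary polynomially with \<open>v\<close>.\<close>

definition orbit_poly :: "(complex^'n^'n) set \<Rightarrow> 'n \<Rightarrow> complex^'n \<Rightarrow> complex poly" where
  "orbit_poly G i v = (\<Prod>g\<in>G. [:- ((g *v v) $ i), 1:])"

text \<open>Right multiplication by \<open>h\<close> permutes \<open>G\<close> and hence only
  reorders the linear factors.\<close>

lemma orbit_poly_invariant: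
  assumes G: "finite_matrix_group G" and h: "h \<in> G"
  shows "orbit_poly G i (h *v v) = orbit_poly G i v"
proof -
  have inv: "invertible h" and hG: "matrix_inv h \<in> G" and cl: "\<And>g k. g \<in> G \<Longrightarrow> k \<in> G \<Longrightarrow> g ** k \<in> G"
    using G h unfolding finite_matrix_group_def by auto
  have "h ** matrix_inv h = mat 1 \<and> matrix_inv h ** h = mat 1"
    using inv unfolding invertible_def matrix_inv_def by (rule someI_ex)
  then have hh: "h ** matrix_inv h = mat 1" "matrix_inv h ** h = mat 1" by simp_all
  show ?thesis
    unfolding orbit_poly_def
    by (rule prod.reindex_bij_witness[where i = "\<lambda>g. g ** matrix_inv h" and j = "\<lambda>g. g ** h"])
       (auto simp: cl h hG hh matrix_mul_assoc[symmetric] matrix_vector_mul_assoc)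
qed

text \<open>The factors are adjoined one at a time, so \<open>G\<close> ranges over arbitrary finite
  sets of matrices, which need not be groups.\<close>

lemma coeff_orbit_poly_poly_fun:
  assumes "finite G"
  shows "poly_fun (\<lambda>v. coeff (orbit_poly G i v) k)"
  using assms unfolding orbit_poly_def
proof (induction G arbitrary: k rule: finite_induct)
  case empty
  then show ?case by (simp add: poly_fun_const)
next
  case (insert g G)
  let ?P = "\<lambda>v. \<Prod>g\<in>G. [:- ((g *v v) $ i), 1:]"
  \<comment> \<open>Multiplying by a monic linear factor adds a multiple of each coefficient to its
    predecessor; the case distinction supplies 0 as predecessor for \<open>k = 0\<close>.\<close>
  have eq: "coeff (\<Prod>g\<in>insert g G. [:- ((g *v v) $ i), 1:]) k
      = (\<Sum>j\<in>UNIV. (- (g $ i $ j)) * v $ j) * coeff (?P v) k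
        + (case k of 0 \<Rightarrow> 0 | Suc m \<Rightarrow> coeff (?P v) m)" for v
    using insert.hyps by (simp add: coeff_pCons matrix_vector_mult_def sum_negf split: nat.split)
  have "poly_fun (\<lambda>v. case k of 0 \<Rightarrow> 0 | Suc m \<Rightarrow> coeff (?P v) m)"
    by (cases k) (simp_all add: poly_fun_const insert.IH)
  then show ?case
    unfolding eq by (intro poly_fun_add poly_fun_mult poly_fun_sum poly_fun_const poly_fun_nth insert.IH)
qed

text \<open>The coordinate \<open>v $ i\<close> is the root of \<open>orbit_poly G i v\<close>
  contributed by the identity matrix. The Cauchy bound turns the polynomial growth of the
  coefficients in \<open>\<sigma> v\<close> into constants \<open>C\<close> and \<open>d\<close>
  independent of \<open>v\<close>.\<close>

lemma norm_nth_le_invariants: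
  fixes G :: "(complex^'n^'n) set" and \<sigma> :: "complex^'n \<Rightarrow> complex^'m"
  assumes G: "finite_matrix_group G" and gen: "generates_invariants G UNIV \<sigma>"
  obtains C d where "C \<ge> 0" "\<And>v. norm (v $ i) \<le> C * (1 + norm (\<sigma> v)) ^ d"
proof -
  have fin: "finite G" and one: "mat 1 \<in> G" using G by (auto simp: finite_matrix_group_def)
  have "\<exists>q. poly_fun q \<and> (\<forall>v. coeff (orbit_poly G i v) k = q (\<sigma> v))" for k
  proof -
    have "invariant_poly G (\<lambda>v. coeff (orbit_poly G i v) k)"
      using coeff_orbit_poly_poly_fun[OF fin] orbit_poly_invariant[OF G]
      by (simp add: invariant_poly_def)
    then show ?thesis using gen unfolding generates_invariants_def by blast
  qed
  then obtain q where q: "\<And>k. poly_fun (q k)" "\<And>k v. coeff (orbit_poly G i v) k = q k (\<sigma> v)"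
    by metis
  have "poly_growth (\<lambda>y. 1 + (\<Sum>k<card G. complex_of_real (norm (q k y))))"
    by (intro poly_growth_add poly_growth_const poly_growth_sum poly_growth_norm poly_fun_growth q(1))
  then obtain C d where C: "C \<ge> 0"
    "\<And>y. norm (1 + (\<Sum>k<card G. complex_of_real (norm (q k y)))) \<le> C * (1 + norm y) ^ d"
    by (rule poly_growthE) blast
  have "norm (v $ i) \<le> C * (1 + norm (\<sigma> v)) ^ d" for v
  proof -
    let ?P = "orbit_poly G i v"
    have deg: "degree ?P = card G"
      unfolding orbit_poly_def by (subst degree_prod_eq_sum_degree) auto
    have "lead_coeff ?P = 1"
      unfolding orbit_poly_def lead_coeff_prod by simp
    moreover have "degree ?P > 0"
      using fin one deg by (auto simp: card_gt_0_iff)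
    moreover have "poly ?P (v $ i) = 0"
      using fin one by (auto simp: orbit_poly_def poly_prod prod_zero_iff intro!: bexI[of _ "mat 1"])
    ultimately have "norm (v $ i) \<le> 1 + (\<Sum>k<card G. norm (q k (\<sigma> v)))"
      using norm_monic_root_le[of ?P "v $ i"] by (simp add: deg q(2))
    also have "\<dots> = norm (complex_of_real (1 + (\<Sum>k<card G. norm (q k (\<sigma> v)))))"
      unfolding norm_of_real by (rule abs_of_nonneg[symmetric]) (simp add: sum_nonneg)
    also have "\<dots> \<le> C * (1 + norm (\<sigma> v)) ^ d"
      using C(2)[of "\<sigma> v"] by simp
    finally show ?thesis .
  qed
  with C(1) that show ?thesis by blast
qed

section \<open>Regularity of the lift\<close>

text \<open>Each coordinate has a local fraction near \<open>x\<close>. Its denominator is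
  multiplied by a polynomial that vanishes outside the domain of the fraction, so that a nonzero
  value alone certifies membership in \<open>U\<close>. The product over all coordinates is the
  common denominator.\<close>

lemma regular_map_on_common_denominator:
  fixes f :: "complex^'p \<Rightarrow> complex^'m"
  assumes "regular_map_on U f" "x \<in> U"
  obtains Q P where "poly_fun Q" "\<And>j. poly_fun (P j)" "Q x \<noteq> 0"
    "\<And>y. Q y \<noteq> 0 \<Longrightarrow> y \<in> U" "\<And>y j. Q y \<noteq> 0 \<Longrightarrow> Q y * f y $ j = P j y"
proof -
  have "\<exists>p q. poly_fun p \<and> poly_fun q \<and> q x \<noteq> 0 \<and> (\<forall>y. q y \<noteq> 0 \<longrightarrow> y \<in> U \<and> q y * f y $ j = p y)" for j
  proof -
    obtain p q W where pq: "poly_fun p" "poly_fun q" "zariski_open W" "x \<in> W" "W \<subseteq> U"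
      and W: "\<And>y. y \<in> W \<Longrightarrow> q y \<noteq> 0 \<and> f y $ j = p y / q y"
      using assms unfolding regular_map_on_def regular_fun_on_def by blast
    \<comment> \<open>One of the polynomials cutting out the complement of \<open>W\<close> is
      nonzero at \<open>x\<close>; it vanishes off \<open>W\<close>.\<close>
    obtain r where r: "poly_fun r" "r x \<noteq> 0" "\<And>y. r y \<noteq> 0 \<Longrightarrow> y \<in> W"
      using pq(3,4) unfolding zariski_open_def by auto
    have "poly_fun (\<lambda>y. r y * p y)" "poly_fun (\<lambda>y. r y * q y)"
      using pq r by (auto intro: poly_fun_mult)
    moreover have "r x * q x \<noteq> 0" using r W pq by simp
    moreover have "y \<in> U \<and> (r y * q y) * f y $ j = r y * p y" if "r y * q y \<noteq> 0" for y
      using that r(3)[of y] W[of y] pq(5) by auto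
    ultimately show ?thesis
      by (intro exI[of _ "\<lambda>y. r y * p y"] exI[of _ "\<lambda>y. r y * q y"] conjI allI impI) auto
  qed
  then obtain p q where pq: "\<And>j. poly_fun (p j)" "\<And>j. poly_fun (q j)" "\<And>j. q j x \<noteq> 0"
    "\<And>j y. q j y \<noteq> 0 \<Longrightarrow> y \<in> U" "\<And>j y. q j y \<noteq> 0 \<Longrightarrow> q j y * f y $ j = p j y"
    by metis
  show ?thesis
  proof (rule that)
    show "poly_fun (\<lambda>y. \<Prod>j\<in>UNIV. q j y)" by (intro poly_fun_prod pq)
    show "poly_fun (\<lambda>y. p j y * (\<Prod>k\<in>UNIV - {j}. q k y))" for j
      by (intro poly_fun_mult poly_fun_prod pq)
    show "(\<Prod>j\<in>UNIV. q j x) \<noteq> 0" using pq(3) by simp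
    show "y \<in> U" if "(\<Prod>j\<in>UNIV. q j y) \<noteq> 0" for y
      using that pq(4) by auto
    show "(\<Prod>j\<in>UNIV. q j y) * f y $ j = p j y * (\<Prod>k\<in>UNIV - {j}. q k y)"
      if "(\<Prod>j\<in>UNIV. q j y) \<noteq> 0" for y j
      using that pq(5)[of j y] by (simp add: prod.remove[of UNIV j])
  qed
qed

text \<open>The derivative \<open>L\<close> is a real one; its complex homogeneity makes the
  restriction to a coordinate line act as multiplication by the complex number
  \<open>L (axis k 1) $ i\<close>.\<close>

lemma holo_map_on_vec_upd_field_differentiable:
  assumes "holo_map_on U F" "vec_upd x k z \<in> U"
  shows "(\<lambda>w. F (vec_upd x k w) $ i) field_differentiable (at z)"
proof -
  obtain L where L: "(F has_derivative L) (at (vec_upd x k z))" "\<And>c v. L (c *s v) = c *s L v"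
    using assms unfolding holo_map_on_def by blast
  have "((\<lambda>w. F (vec_upd x k w)) has_derivative (\<lambda>h. L (axis k h))) (at z)"
    using has_derivative_compose[OF has_derivative_vec_upd L(1)] .
  then have "((\<lambda>w. F (vec_upd x k w) $ i) has_derivative (\<lambda>h. L (axis k h) $ i)) (at z)"
    by (rule bounded_linear.has_derivative[OF bounded_linear_vec_nth])
  moreover have "L (axis k h) $ i = L (axis k 1) $ i * h" for h
  proof -
    have "axis k h = h *s axis k 1" by (simp add: vec_eq_iff axis_def)
    then show ?thesis by (simp add: L(2))
  qed
  ultimately have "((\<lambda>w. F (vec_upd x k w) $ i) has_field_derivative L (axis k 1) $ i) (at z)"
    unfolding has_field_derivative_def by (rule has_derivative_eq_rhs[OF _ ext])
  then show ?thesis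
    unfolding field_differentiable_def by blast
qed

text \<open>Because \<open>u z = 0\<close>, the difference quotient of the product is that of
  \<open>u\<close> times \<open>w\<close>, which tends to 0. This gives differentiability at the
  zeros of the denominator.\<close>

lemma field_differentiable_mult_zero:
  fixes u w :: "complex \<Rightarrow> complex"
  assumes "u field_differentiable (at z)" "u z = 0" "(w \<longlongrightarrow> 0) (at z)"
  shows "(\<lambda>t. u t * w t) field_differentiable (at z)"
proof -
  obtain D where "((\<lambda>t. (u t - u z) / (t - z)) \<longlongrightarrow> D) (at z)"
    using assms(1) unfolding field_differentiable_def has_field_derivative_iff by blast
  from tendsto_mult[OF this assms(3)]
  have "((\<lambda>t. (u t * w t - u z * w z) / (t - z)) \<longlongrightarrow> 0) (at z)"
    using assms(2) by simp
  then show ?thesis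
    unfolding field_differentiable_def has_field_derivative_iff by blast
qed

text \<open>Over the unit disc around \<open>z\<close> the points \<open>vec_upd x k w\<close> stay
  bounded, and polynomial growth bounds \<open>h\<close> there.\<close>

lemma poly_growth_vec_upd_bounded_near:
  fixes h :: "complex^'n \<Rightarrow> complex"
  assumes "poly_growth h"
  obtains B where "\<forall>\<^sub>F w in at z. norm (h (vec_upd x k w)) \<le> B"
proof -
  obtain C d where C: "C \<ge> 0" "\<And>x. norm (h x) \<le> C * (1 + norm x) ^ d" using assms by (rule poly_growthE) blast
  have "norm (h (vec_upd x k w)) \<le> C * (1 + (norm x + norm (x $ k) + (norm z + 1))) ^ d"
    if "dist w z < 1" for w
  proof -
    have "norm w \<le> norm z + 1"
      using that norm_triangle_sub[of w z] by (simp add: dist_norm)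
    then have "norm (vec_upd x k w) \<le> norm x + norm (x $ k) + (norm z + 1)"
      using norm_vec_upd_le[of x k w] by simp
    then have "C * (1 + norm (vec_upd x k w)) ^ d \<le> C * (1 + (norm x + norm (x $ k) + (norm z + 1))) ^ d"
      using C(1) by (intro mult_left_mono power_mono) auto
    then show ?thesis using C(2) order.trans by blast
  qed
  then show ?thesis
    by (intro that) (auto simp: eventually_at intro!: exI[of _ 1])
qed

theorem theorem4p5:
  fixes G :: "(complex^'n^'n) set"
    and \<sigma> :: "complex^'n \<Rightarrow> complex^'m"
    and U :: "(complex^'p) set"
    and f :: "complex^'p \<Rightarrow> complex^'m"
    and F :: "complex^'p \<Rightarrow> complex^'n"
  assumes "finite_matrix_group G"
    and "min_homog_generators G \<sigma>"
    and "zariski_open U"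
    and "regular_map_on U f"
    and "\<forall>x\<in>U. f x \<in> range \<sigma>"
    and "{x\<in>U. f x \<in> \<sigma> ` V0 G} \<noteq> {}"
    and "holo_map_on U F"
    and "\<forall>x\<in>U. \<sigma> (F x) = f x"
  shows "regular_map_on U F"
  unfolding regular_map_on_def regular_fun_on_def
proof (intro allI ballI)
  fix i x
  assume "x \<in> U"
  have gen: "generates_invariants G UNIV \<sigma>" using assms(2) by (simp add: min_homog_generators_def)
  obtain C d where C: "C \<ge> 0" and bound: "\<And>v. norm (v $ i) \<le> C * (1 + norm (\<sigma> v)) ^ d"
    using norm_nth_le_invariants[OF assms(1) gen] by blast
  obtain Q P where Q: "poly_fun Q" "\<And>j. poly_fun (P j)" "Q x \<noteq> 0"
    and QU: "\<And>y. Q y \<noteq> 0 \<Longrightarrow> y \<in> U" and QP: "\<And>y j. Q y \<noteq> 0 \<Longrightarrow> Q y * f y $ j = P j y"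
    using regular_map_on_common_denominator[OF assms(4) \<open>x \<in> U\<close>] by blast
  \<comment> \<open>The exponent \<open>d\<close> is that of \<open>bound\<close>: the factor
    \<open>Q y ^ d\<close> absorbs the poles of \<open>(1 + norm (f y)) ^ d\<close>.\<close>
  define H where "H y = (if Q y = 0 then 0 else Q y ^ d * F y $ i)" for y
  \<comment> \<open>Near a zero of \<open>Q\<close> on a line, \<open>H\<close> is bounded: one
    factor \<open>Q\<close> forces the limit 0, and the other then yields a complex
    derivative.\<close>
  define K where "K y = Q y * (Q y * H y)" for y
  have "poly_growth H"
  proof (rule poly_growth_mono)
    \<comment> \<open>Where \<open>Q y\<close> is nonzero, \<open>Q y * f y $ j = P j y\<close>
      shows that \<open>?R y\<close> dominates \<open>norm (Q y) * (1 + norm (f y))\<close>.\<close>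
    let ?R = "\<lambda>y. complex_of_real (norm (Q y)) + (\<Sum>j\<in>UNIV. complex_of_real (norm (P j y)))"
    show "poly_growth (\<lambda>y. of_real C * ?R y ^ d)"
      by (intro poly_growth_mult poly_growth_power poly_growth_add poly_growth_sum poly_growth_norm
          poly_growth_const poly_fun_growth Q)
    fix y
    show "norm (H y) \<le> norm (of_real C * ?R y ^ d)"
    proof (cases "Q y = 0")
      case False
      have R: "norm (?R y) = norm (Q y) + (\<Sum>j\<in>UNIV. norm (P j y))"
      proof -
        have "?R y = of_real (norm (Q y) + (\<Sum>j\<in>UNIV. norm (P j y)))" by simp
        then show ?thesis
          unfolding norm_of_real by (metis abs_of_nonneg add_nonneg_nonneg norm_ge_zero norm_of_real sum_nonneg)
      qed
      have "norm (Q y) * norm (f y) \<le> norm (Q y) * (\<Sum>j\<in>UNIV. norm (f y $ j))"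
        unfolding norm_vec_def by (intro mult_left_mono L2_set_le_sum) auto
      also have "\<dots> = (\<Sum>j\<in>UNIV. norm (P j y))"
        by (simp add: sum_distrib_left norm_mult[symmetric] QP[OF False])
      finally have "norm (Q y) * (1 + norm (f y)) \<le> norm (?R y)"
        unfolding R by (simp add: algebra_simps)
      then have le: "(norm (Q y) * (1 + norm (f y))) ^ d \<le> norm (?R y) ^ d"
        by (intro power_mono) auto
      have "norm (H y) \<le> norm (Q y) ^ d * (C * (1 + norm (f y)) ^ d)"
        using bound[of "F y"] assms(8) QU[OF False] False
        by (auto simp: H_def norm_mult norm_power intro!: mult_left_mono)
      also have "\<dots> = C * (norm (Q y) * (1 + norm (f y))) ^ d"
        by (simp add: power_mult_distrib)
      also have "\<dots> \<le> C * norm (?R y) ^ d"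
        using le C by (rule mult_left_mono)
      finally show ?thesis using C by (simp add: norm_mult norm_power)
    qed (simp add: H_def)
  qed
  have "poly_fun K"
  proof (rule poly_fun_if_separately_entire)
    show "poly_growth K"
      unfolding K_def by (intro poly_growth_mult poly_fun_growth Q \<open>poly_growth H\<close>)
    fix a k
    let ?Q = "\<lambda>w. Q (vec_upd a k w)"
    have Qhol: "?Q holomorphic_on UNIV"
      by (rule poly_fun_vec_upd_holomorphic[OF Q(1)])
    then have Qcont: "continuous_on UNIV ?Q" by (rule holomorphic_on_imp_continuous_on)
    have Qdiff: "?Q field_differentiable (at z)" for z
      using Qhol by (simp add: holomorphic_on_def)
    have "(\<lambda>w. K (vec_upd a k w)) field_differentiable (at z)" for z
    \<comment> \<open>Zeros of \<open>?Q\<close> may fail to be isolated, as the whole line can lie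
      in the zero set of \<open>Q\<close>; the estimate at a zero covers this too.\<close>
    proof (cases "?Q z = 0")
      case True
      obtain B where B: "\<forall>\<^sub>F w in at z. norm (H (vec_upd a k w)) \<le> B"
        using poly_growth_vec_upd_bounded_near[OF \<open>poly_growth H\<close>] by blast
      have "(?Q \<longlongrightarrow> 0) (at z)"
        using Qcont True by (metis UNIV_I continuous_on_def)
      then have "((\<lambda>w. norm (?Q w) * B) \<longlongrightarrow> 0) (at z)"
        by (intro tendsto_mult_left_zero tendsto_norm_zero)
      moreover have "\<forall>\<^sub>F w in at z. norm (?Q w * H (vec_upd a k w)) \<le> norm (?Q w) * B"
        using B by eventually_elim (auto simp: norm_mult intro: mult_left_mono)
      ultimately have "((\<lambda>w. ?Q w * H (vec_upd a k w)) \<longlongrightarrow> 0) (at z)"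
        by (rule Lim_null_comparison[rotated])
      then show ?thesis
        unfolding K_def by (rule field_differentiable_mult_zero[OF Qdiff True])
    next
      case False
      \<comment> \<open>On this open set \<open>K\<close> coincides with the product of
        \<open>Q ^ (d + 2)\<close> and the lift, which is differentiable since the points lie in
        \<open>U\<close>.\<close>
      have op: "open {w. ?Q w \<noteq> 0}"
        using Qcont by (rule open_Collect_neq[OF _ continuous_on_const])
      have "(\<lambda>w. ?Q w * (?Q w * (?Q w ^ d * F (vec_upd a k w) $ i))) field_differentiable (at z)"
        using holo_map_on_vec_upd_field_differentiable[OF assms(7) QU[OF False]]
        by (intro derivative_intros Qdiff field_differentiable_mult field_differentiable_power)
      then obtain D where "((\<lambda>w. ?Q w * (?Q w * (?Q w ^ d * F (vec_upd a k w) $ i))) has_field_derivative D) (at z)"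
        unfolding field_differentiable_def by blast
      then have "((\<lambda>w. K (vec_upd a k w)) has_field_derivative D) (at z)"
        using op by (rule has_field_derivative_transform_within_open) (use False in \<open>auto simp: K_def H_def\<close>)
      then show ?thesis unfolding field_differentiable_def by blast
    qed
    then show "(\<lambda>z. K (vec_upd a k z)) holomorphic_on UNIV"
      by (simp add: holomorphic_on_def)
  qed
  moreover have "poly_fun (\<lambda>y. Q y ^ (d + 2))" by (intro poly_fun_power Q)
  moreover have "zariski_open {y. Q y \<noteq> 0}"
    unfolding zariski_open_def by (rule exI[of _ "{Q}"]) (use Q(1) in auto)
  \<comment> \<open>The exponent collects the \<open>d\<close> factors in \<open>H\<close> and the
    two in \<open>K\<close>.\<close>
  moreover have "F y $ i = K y / Q y ^ (d + 2)" if "Q y \<noteq> 0" for y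
    using that by (simp add: K_def H_def power_add power2_eq_square)
  ultimately show "\<exists>p q W. poly_fun p \<and> poly_fun q \<and> zariski_open W \<and> x \<in> W \<and> W \<subseteq> U \<and>
      (\<forall>y\<in>W. q y \<noteq> 0 \<and> F y $ i = p y / q y)"
    using Q(3) QU
    by (intro exI[of _ K] exI[of _ "\<lambda>y. Q y ^ (d + 2)"] exI[of _ "{y. Q y \<noteq> 0}"]) auto
qed

end
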